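(* Consider the Lipschitz experts problem on a metric space $(X,\mathcal{D})$. For each $b>\mathrm{LCD}(X)$, the algorithm $\mathrm{NaiveExp}(b)$ achieves regret $R(t)=O(t^{1-1/(b+2)})$.
   Context: Lipschitz experts problem on $(X,\mathcal{D})$ (diameter at most 1, known): an instance is an unknown Borel probability measure $\mathbb{P}$ on $[0,1]^X$ with $\mu(x)=\mathbb{E}_{f\sim\mathbb{P}}[f(x)]$ $1$-Lipschitz; each round the algorithm picks $x_t$, $f_t\sim\mathbb{P}$ is drawn independently, the algorithm receives $f_t(x_t)$ and may observe $f_t$ at any finite number of points. Regret $R(t)=t\sup\mu-\mathbb{E}[\sum_{s\le t}\mu(x_s)]$. $N_\delta(X)$: smallest number of sets of diameter at most $\delta$ covering $X$; $\mathrm{LCD}(X)=\limsup_{r\to0}\frac{\log\log N_r(X)}{\log(1/r)}$. A set $S\subseteq X$ is a $\delta$-hitting set for $X$ if $X\subseteq\bigcup_{x\in S}B(x,\delta)$, $B(x,\delta)=\{y:\mathcal{D}(x,y)<\delta\}$. Algorithm $\mathrm{NaiveExp}(b)$: runs in phases $i=1,2,\dots$; phase $i$ lasts $T=2^i$ rounds. In phase $i$ it picks a $\delta$-hitting set $S$ for $X$ of size at most $N_\delta(X)$ with $\delta=T^{-1/(b+2)}$, observes the payoffs of all points of $S$ in every round of the phase, and at the end outputs the best guess $x_i^*\in S$ with the highest sample average (ties arbitrary). Throughout phase $i+1$ it plays $x_i^*$.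
   Formalization: A δ-hitting set (open balls) of size at most N_δ(X) may not exist, e.g. for two points at distance exactly δ, leaving NaiveExp(b) undefined; only in a phase where none exists, the algorithm may use a set of that size whose closed δ-balls cover X. *)

theory Defs
  imports "HOL-Probability.Probability"
begin

text \<open>The metric space \<open>(X, D)\<close> is a type \<open>'a\<close> of class \<open>metric_space\<close>; \<open>X\<close> is \<open>UNIV\<close>.\<close>

definition covering_number :: "'a::metric_space set \<Rightarrow> real \<Rightarrow> enat" where
  "covering_number X \<delta> =
     (INF \<A> \<in> {\<A>. finite \<A> \<and> X \<subseteq> \<Union>\<A> \<and> (\<forall>A\<in>\<A>. bounded A \<and> diameter A \<le> \<delta>)}.
        enat (card \<A>))"

text \<open>Extended logarithm with \<open>log 0 = -\<infinity>\<close> and \<open>log \<infinity> = \<infinity>\<close>; the library's real-valued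
  \<open>ln\<close> has \<open>ln 0 = 0\<close>, which is the wrong value for \<open>log (log 1)\<close>.\<close>

definition eln :: "ereal \<Rightarrow> ereal" where
  "eln u = (if u \<le> 0 then - \<infinity> else if u = \<infinity> then \<infinity> else ereal (ln (real_of_ereal u)))"

definition LCD :: "'a::metric_space set \<Rightarrow> ereal" where
  "LCD X = Limsup (at_right 0)
     (\<lambda>r. eln (eln (ereal_of_enat (covering_number X r))) / ereal (ln (1 / r)))"

definition hitting_set :: "'a::metric_space set \<Rightarrow> real \<Rightarrow> 'a set \<Rightarrow> bool" where
  "hitting_set X \<delta> S \<longleftrightarrow> S \<subseteq> X \<and> X \<subseteq> (\<Union>x\<in>S. ball x \<delta>)"

definition small_hitting_set :: "'a::metric_space set \<Rightarrow> real \<Rightarrow> 'a set \<Rightarrow> bool" where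
  "small_hitting_set X \<delta> S \<longleftrightarrow>
     finite S \<and> enat (card S) \<le> covering_number X \<delta> \<and> hitting_set X \<delta> S"

text \<open>The covering number allows sets of diameter exactly \<open>\<delta>\<close>, whereas a hitting set is defined
  with open balls, so a \<open>\<delta>\<close>-hitting set with at most \<open>covering_number X \<delta>\<close> points need not exist
  (two points at distance exactly \<open>\<delta>\<close>). Only when there is none, closed balls are used instead;
  choosing one point from each set of a minimal cover then yields a legal set.\<close>

definition admissible_net :: "'a::metric_space set \<Rightarrow> real \<Rightarrow> 'a set \<Rightarrow> bool" where
  "admissible_net X \<delta> S \<longleftrightarrow>
     small_hitting_set X \<delta> S \<or>
     ((\<nexists>S'. small_hitting_set X \<delta> S') \<and>
      finite S \<and> enat (card S) \<le> covering_number X \<delta> \<and> S \<subseteq> X \<and> X \<subseteq> (\<Union>x\<in>S. cball x \<delta>))"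

definition mean_payoff :: "('a \<Rightarrow> real) measure \<Rightarrow> 'a \<Rightarrow> real" where
  "mean_payoff P x = (\<integral>f. f x \<partial>P)"

text \<open>Here \<open>borel\<close> is the Borel algebra of the product topology on \<open>'a \<Rightarrow> real\<close>, so \<open>P\<close> is a
  Borel measure whose space is \<open>[0,1]\<^sup>X\<close>.\<close>

definition experts_instance :: "('a::metric_space \<Rightarrow> real) measure \<Rightarrow> bool" where
  "experts_instance P \<longleftrightarrow>
     prob_space P \<and> sets P = sets (restrict_space borel (UNIV \<rightarrow> {0..1})) \<and>
     1-lipschitz_on UNIV (mean_payoff P)"

text \<open>Rounds are numbered from 1. The probability space \<open>M\<close> is arbitrary, so it may carry
  randomness beyond the payoff functions \<open>F t\<close>.\<close>

definition iid_payoffs ::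
  "'w measure \<Rightarrow> ('a \<Rightarrow> real) measure \<Rightarrow> (nat \<Rightarrow> 'w \<Rightarrow> 'a \<Rightarrow> real) \<Rightarrow> bool" where
  "iid_payoffs M P F \<longleftrightarrow>
     prob_space M \<and> prob_space.indep_vars M (\<lambda>_. P) F {1..} \<and> (\<forall>t\<ge>1. distr M P (F t) = P)"

text \<open>Phases \<open>1, \<dots>, i - 1\<close> take \<open>2 + \<dots> + 2 ^ (i - 1) = 2 ^ i - 2\<close> rounds.\<close>

definition phase :: "nat \<Rightarrow> nat set" where
  "phase i = {2 ^ i - 1 .. 2 ^ (i + 1) - 2}"

definition sample_average :: "(nat \<Rightarrow> 'w \<Rightarrow> 'a \<Rightarrow> real) \<Rightarrow> nat \<Rightarrow> 'w \<Rightarrow> 'a \<Rightarrow> real" where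
  "sample_average F i \<omega> y = (\<Sum>t\<in>phase i. F t \<omega> y) / 2 ^ i"

text \<open>\<open>S i\<close> is the set picked in phase \<open>i\<close>, \<open>g i\<close> the best guess output at its end, and \<open>x t\<close> the
  point played in round \<open>t\<close>. The description of the algorithm does not say what is played in
  phase 1, so \<open>x t\<close> is an arbitrary random point there. Ties in \<open>g i\<close> are broken arbitrarily, but
  measurably, since otherwise the expected payoff would be undefined.\<close>

definition naive_exp_run ::
  "real \<Rightarrow> 'w measure \<Rightarrow> (nat \<Rightarrow> 'w \<Rightarrow> 'a::metric_space \<Rightarrow> real) \<Rightarrow> (nat \<Rightarrow> 'a set) \<Rightarrow>
   (nat \<Rightarrow> 'w \<Rightarrow> 'a) \<Rightarrow> (nat \<Rightarrow> 'w \<Rightarrow> 'a) \<Rightarrow> bool" where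
  "naive_exp_run b M F S g x \<longleftrightarrow>
     (\<forall>i\<ge>1. admissible_net UNIV ((2 ^ i) powr (- 1 / (b + 2))) (S i)) \<and>
     (\<forall>i\<ge>1. \<forall>\<omega>\<in>space M. g i \<omega> \<in> S i \<and>
        (\<forall>y\<in>S i. sample_average F i \<omega> y \<le> sample_average F i \<omega> (g i \<omega>))) \<and>
     (\<forall>i\<ge>1. \<forall>t\<in>phase (i + 1). \<forall>\<omega>\<in>space M. x t \<omega> = g i \<omega>) \<and>
     (\<forall>t\<ge>1. x t \<in> borel_measurable M)"

definition regret ::
  "'w measure \<Rightarrow> ('a \<Rightarrow> real) measure \<Rightarrow> (nat \<Rightarrow> 'w \<Rightarrow> 'a) \<Rightarrow> nat \<Rightarrow> real" where
  "regret M P x t =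
     real t * (SUP y. mean_payoff P y) - (\<integral>\<omega>. (\<Sum>s=1..t. mean_payoff P (x s \<omega>)) \<partial>M)"

end

theory Submission
  imports Defs "HOL-Real_Asymp.Real_Asymp"
begin

text \<open>With \<open>T = 2 ^ i\<close> and \<open>\<delta> = T powr (- 1 / (b + 2))\<close> one has \<open>T * \<delta>\<^sup>2 = \<delta> powr (- b)\<close>, and
  \<open>b > LCD\<close> gives \<open>N\<^sub>\<delta> \<le> exp (\<delta> powr (- b))\<close> for small \<open>\<delta>\<close>. Hoeffding's inequality and a union bound
  over the net then show that all sample averages of phase \<open>i\<close> are \<open>\<delta>\<close>-accurate except with probability
  \<open>2 * exp (- (\<delta> powr (- b)))\<close>, which is \<open>O(\<delta>)\<close> when \<open>b > 0\<close>. So each round \<open>s\<close> of phase \<open>i + 1\<close> costs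
  \<open>O(\<delta>)\<close>, that is \<open>O(s powr (- 1 / (b + 2)))\<close>, and summing over \<open>s\<close> yields the bound. If \<open>b \<le> 0\<close>,
  the space has only one point and there is no regret.\<close>

section \<open>Covering numbers and the sign of the log-covering dimension\<close>

text \<open>For \<open>r < 1\<close> the divisor \<open>ln (1 / r)\<close> is positive, so the
  strict bound on the limsup can be multiplied out and exponentiated twice.\<close>

lemma eventually_covering_number_le_exp:
  assumes "LCD X < ereal b"
  shows "\<forall>\<^sub>F r in at_right 0. \<exists>m. covering_number X r = enat m \<and> real m \<le> exp (r powr (- b))"
proof -
  have "\<forall>\<^sub>F r in at_right 0.
      eln (eln (ereal_of_enat (covering_number X r))) / ereal (ln (1 / r)) < ereal b"
    using assms unfolding LCD_def by (rule Limsup_lessD)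
  moreover have "\<forall>\<^sub>F r::real in at_right 0. 0 < r \<and> r < 1"
    using eventually_at_right_real[of 0 1] by (simp add: eventually_mono)
  ultimately show ?thesis
  proof eventually_elim
    case (elim r)
    define L where "L = ln (1 / r)"
    have L: "L > 0" using elim(2) by (simp add: L_def)
    \<comment> \<open>An infinite covering number would make the quotient infinite, hence not below
      \<open>b\<close>.\<close>
    have "covering_number X r \<noteq> \<infinity>"
    proof
      assume "covering_number X r = \<infinity>"
      with elim(1) L show False by (simp add: eln_def L_def)
    qed
    then obtain m where m: "covering_number X r = enat m" by auto
    have "real m \<le> exp (r powr (- b))"
    \<comment> \<open>For \<open>m \<le> 1\<close> the iterated logarithm is not a finite real, but
      the right-hand side is at least 1 anyway.\<close>
    proof (cases "m \<le> 1")
      case True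
      hence "real m \<le> 1" by simp
      also have "1 \<le> exp (r powr (- b))" by simp
      finally show ?thesis .
    next
      case False
      hence m1: "real m > 1" by simp
      have "eln (eln (ereal_of_enat (covering_number X r))) = ereal (ln (ln (real m)))"
        using m1 by (simp add: m eln_def)
      with elim(1) L have "ln (ln (real m)) / L < b" by (simp add: L_def[symmetric])
      hence "ln (ln (real m)) < b * L" using L by (simp add: field_simps)
      hence "exp (ln (ln (real m))) < exp (b * L)" by simp
      hence "ln (real m) < exp (b * L)" using m1 by simp
      also have "exp (b * L) = r powr (- b)"
        using elim(2) by (simp add: powr_def L_def ln_div)
      finally have "exp (ln (real m)) < exp (r powr (- b))" by simp
      thus ?thesis using m1 by simp
    qed
    with m show ?case by blast
  qed
qed

text \<open>Points farther apart than \<open>r\<close> cannot share a set of diameter at most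
  \<open>r\<close>.\<close>

lemma two_le_covering_number:
  assumes "x \<in> X" "y \<in> X" "r < dist x y"
  shows "2 \<le> covering_number X r"
  unfolding covering_number_def
proof (rule INF_greatest)
  fix \<A>
  assume "\<A> \<in> {\<A>. finite \<A> \<and> X \<subseteq> \<Union>\<A> \<and> (\<forall>A\<in>\<A>. bounded A \<and> diameter A \<le> r)}"
  hence A: "finite \<A>" "X \<subseteq> \<Union>\<A>" "\<forall>A\<in>\<A>. bounded A \<and> diameter A \<le> r"
    by auto
  obtain A B where AB: "A \<in> \<A>" "x \<in> A" "B \<in> \<A>" "y \<in> B" using A(2) assms by blast
  have "A \<noteq> B"
    using AB A(3) assms(3) diameter_bounded_bound[of A x y] by force
  hence "2 = card {A, B}" by simp
  also have "\<dots> \<le> card \<A>" using AB A(1) by (intro card_mono) auto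
  finally show "2 \<le> enat (card \<A>)" by (simp add: numeral_eq_enat)
qed

lemma eln_mono: "u \<le> v \<Longrightarrow> eln u \<le> eln v"
  by (cases u; cases v) (auto simp: eln_def)

text \<open>Two points force covering number at least 2 at small radii, and
  \<open>ln (ln 2) / ln (1 / r)\<close>, though negative, tends to 0. This is what makes
  \<open>b\<close> positive in the main argument.\<close>

lemma LCD_nonneg:
  assumes "x \<in> X" "y \<in> X" "x \<noteq> y"
  shows "0 \<le> LCD X"
proof -
  have lim: "((\<lambda>r. ereal (ln (ln 2) / ln (1 / r))) \<longlongrightarrow> ereal 0) (at_right 0)"
    by (rule tendsto_ereal) real_asymp
  have "ereal 0 = Limsup (at_right 0) (\<lambda>r. ereal (ln (ln 2) / ln (1 / r)))"
    using lim_imp_Limsup[OF _ lim] by simp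
  also have "\<dots> \<le> LCD X"
    unfolding LCD_def
  proof (rule Limsup_mono)
    have "0 < min 1 (dist x y)" using assms by simp
    from eventually_at_right_real[OF this]
    have "\<forall>\<^sub>F r::real in at_right 0. 0 < r \<and> r < min 1 (dist x y)"
      by (rule eventually_mono) simp
    thus "\<forall>\<^sub>F r in at_right 0. ereal (ln (ln 2) / ln (1 / r))
        \<le> eln (eln (ereal_of_enat (covering_number X r))) / ereal (ln (1 / r))"
    proof eventually_elim
      case (elim r)
      have L: "0 < ln (1 / r)" using elim by simp
      have "2 \<le> covering_number X r" using two_le_covering_number[OF assms(1,2)] elim by simp
      hence "ereal_of_enat 2 \<le> ereal_of_enat (covering_number X r)"
        by (simp only: ereal_of_enat_le_iff)
      hence "eln (eln (ereal_of_enat 2)) \<le> eln (eln (ereal_of_enat (covering_number X r)))"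
        by (intro eln_mono)
      moreover have "eln (eln (ereal_of_enat 2)) = ereal (ln (ln 2))"
        by (simp add: eln_def numeral_eq_enat)
      ultimately have "ereal (ln (ln 2)) / ereal (ln (1 / r))
          \<le> eln (eln (ereal_of_enat (covering_number X r))) / ereal (ln (1 / r))"
        using L by (intro ereal_divide_right_mono) auto
      thus ?case using L by simp
    qed
  qed
  finally show ?thesis by (simp add: zero_ereal_def)
qed

section \<open>Elementary estimates for powers and exponentials\<close>

text \<open>Taking logarithms, this is \<open>ln (b * u) \<le> b * u - 1\<close> for \<open>u = r powr (- b)\<close>.\<close>

lemma exp_neg_powr_le:
  fixes b r :: real
  assumes "b > 0" "r > 0"
  shows "exp (- (r powr (- b))) \<le> exp (- (1 + ln b) / b) * r"
proof -
  have "ln (b * r powr (- b)) \<le> b * r powr (- b) - 1"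
    using assms by (intro ln_le_minus_one) auto
  hence "ln b - b * ln r \<le> b * r powr (- b) - 1"
    using assms by (simp add: ln_mult ln_powr)
  hence "- (r powr (- b)) \<le> - (1 + ln b) / b + ln r"
    using assms by (simp add: field_simps)
  hence "exp (- (r powr (- b))) \<le> exp (- (1 + ln b) / b + ln r)" by simp
  also have "\<dots> = exp (- (1 + ln b) / b) * r" using assms by (simp add: exp_add)
  finally show ?thesis .
qed

text \<open>Since \<open>a \<le> 1 / 2\<close>, the factor \<open>s powr (1 / 2 - a)\<close> is
  largest at \<open>s = t\<close>. Pulling it out leaves the sum of \<open>1 / sqrt s\<close>, so
  the constant 2 does not depend on \<open>a\<close>.\<close>

lemma sum_powr_neg_le:
  fixes a :: real
  assumes "a \<le> 1 / 2"
  shows "(\<Sum>s=1..t. real s powr (- a)) \<le> 2 * real t powr (1 - a)"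
proof (cases "t = 0")
  case False
  have sqrt: "(\<Sum>s=1..n. 1 / sqrt (real s)) \<le> 2 * sqrt (real n)" for n
  proof (induction n)
    case (Suc n)
    define p q where "p = sqrt (real (Suc n))" and "q = sqrt (real n)"
    have pq: "p > 0" "q \<ge> 0" "p\<^sup>2 = q\<^sup>2 + 1" "q \<le> p" by (auto simp: p_def q_def)
    \<comment> \<open>With \<open>p\<^sup>2 = q\<^sup>2 + 1\<close> this becomes
      \<open>1 / p \<le> 2 * (p - q)\<close>, the increment needed for the induction.\<close>
    have "2 * p * q \<le> p\<^sup>2 + q\<^sup>2" by (rule sum_squares_bound)
    hence "2 * q * p + 1 \<le> 2 * p * p" using pq by (simp add: power2_eq_square algebra_simps)
    hence "2 * q + 1 / p \<le> 2 * p" using pq by (simp add: field_simps)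
    thus ?case using Suc by (simp add: p_def q_def)
  qed simp
  have "(\<Sum>s=1..t. real s powr (- a)) \<le> (\<Sum>s=1..t. real t powr (1 / 2 - a) * (1 / sqrt (real s)))"
  proof (rule sum_mono)
    fix s assume s: "s \<in> {1..t}"
    have "real s powr (- a) = real s powr (1 / 2 - a) * real s powr (- (1 / 2))"
      by (subst powr_add[symmetric]) simp
    also have "real s powr (- (1 / 2)) = 1 / sqrt (real s)"
      using s by (simp add: powr_minus_divide powr_half_sqrt)
    also have "real s powr (1 / 2 - a) * (1 / sqrt (real s))
        \<le> real t powr (1 / 2 - a) * (1 / sqrt (real s))"
      using s assms by (intro mult_right_mono powr_mono2) auto
    finally show "real s powr (- a) \<le> real t powr (1 / 2 - a) * (1 / sqrt (real s))" .
  qed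
  also have "\<dots> \<le> real t powr (1 / 2 - a) * (2 * sqrt (real t))"
    unfolding sum_distrib_left[symmetric] by (intro mult_left_mono sqrt) auto
  also have "\<dots> = 2 * (real t powr (1 / 2 - a) * real t powr (1 / 2))"
    by (simp add: powr_half_sqrt)
  also have "\<dots> = 2 * real t powr (1 - a)"
    by (subst powr_add[symmetric]) simp
  finally show ?thesis .
qed simp

section \<open>Payoffs at a point as bounded random variables\<close>

lemma eval_measurable:
  assumes "experts_instance P"
  shows "(\<lambda>f. f y) \<in> borel_measurable P"
proof -
  have "(\<lambda>f. f y) \<in> borel_measurable (restrict_space borel (UNIV \<rightarrow> {0..1}))"
    by (intro measurable_restrict_space1 measurable_product_coordinates)
  moreover have "sets P = sets (restrict_space borel (UNIV \<rightarrow> {0..1}))"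
    using assms by (simp add: experts_instance_def)
  ultimately show ?thesis by (simp cong: measurable_cong_sets)
qed

lemma space_experts_instance: "experts_instance P \<Longrightarrow> space P = UNIV \<rightarrow> {0..1}"
  unfolding experts_instance_def
  using sets_eq_imp_space_eq[of P "restrict_space borel (UNIV \<rightarrow> {0..1})"]
  by (simp add: space_restrict_space)

lemma mean_payoff_bounds:
  assumes "experts_instance P"
  shows "0 \<le> mean_payoff P y" "mean_payoff P y \<le> 1"
proof -
  interpret prob_space P using assms by (simp add: experts_instance_def)
  have ae: "AE f in P. 0 \<le> f y \<and> f y \<le> 1"
    using space_experts_instance[OF assms] by (intro AE_I2) (auto simp: Pi_iff)
  hence int: "integrable P (\<lambda>f. f y)"
    using eval_measurable[OF assms] by (intro integrable_const_bound[of _ 1]) auto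
  show "0 \<le> mean_payoff P y" unfolding mean_payoff_def
    using ae by (intro integral_nonneg_AE) auto
  show "mean_payoff P y \<le> 1" unfolding mean_payoff_def
    using ae by (intro integral_le_const int) auto
qed

section \<open>Lengths of the phases and the phase of a given round\<close>

lemma card_phase: "card (phase i) = 2 ^ i"
proof -
  have "(2::nat) ^ i \<ge> 1" by simp
  thus ?thesis unfolding phase_def card_atLeastAtMost power_add power_one_right by linarith
qed

text \<open>Phase 1 consists of rounds 1 and 2, so from round 3 on a best guess is being played. The
  factor 4 comes from the last round of phase \<open>i + 1\<close>, which is
  \<open>2 ^ (i + 2) - 2\<close>.\<close>

lemma phase_cover:
  assumes "t \<ge> 3"
  obtains i where "i \<ge> 1" "t \<in> phase (i + 1)" "real t \<le> 4 * 2 ^ i"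
proof -
  obtain n where n: "2 ^ n \<le> t + 1" "t + 1 < 2 ^ (n + 1)"
    using ex_power_ivl1[of 2 "t + 1"] by auto
  have "n \<ge> 2"
  proof (rule ccontr)
    assume "\<not> n \<ge> 2"
    hence "(2::nat) ^ (n + 1) \<le> 2 ^ 2" by (intro power_increasing) auto
    thus False using n assms by simp
  qed
  then obtain i where i: "n = i + 1" "i \<ge> 1" by (cases n) auto
  have "t < 2 ^ (n + 1)" using n by simp
  hence "real t < real (2 ^ (n + 1))" by (simp only: of_nat_less_iff)
  hence "real t \<le> 4 * 2 ^ i" by (simp add: i)
  moreover have "t \<in> phase (i + 1)" using n by (auto simp: phase_def i)
  ultimately show thesis using that i by blast
qed

section \<open>Concentration of sample averages and quality of the best guess\<close>

text \<open>Hoeffding's inequality for the \<open>2 ^ i\<close> independent payoffs at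
  \<open>y\<close>, all in \<open>[0,1]\<close>. Measurability of the event is recorded for the
  union bound.\<close>

lemma prob_sample_average_deviation:
  assumes P: "experts_instance P" and F: "iid_payoffs M P F" and i: "i \<ge> 1" and "\<epsilon> \<ge> 0"
  shows "measure M {\<omega>\<in>space M. \<epsilon> \<le> \<bar>sample_average F i \<omega> y - mean_payoff P y\<bar>}
           \<le> 2 * exp (- 2 * 2 ^ i * \<epsilon>\<^sup>2)" (is ?bound)
    and "{\<omega>\<in>space M. \<epsilon> \<le> \<bar>sample_average F i \<omega> y - mean_payoff P y\<bar>} \<in> sets M"
proof -
  interpret prob_space M using F by (simp add: iid_payoffs_def)
  have sub: "phase i \<subseteq> {1..}"
  proof -
    have "(2::nat) ^ 1 \<le> 2 ^ i" using i by (intro power_increasing) auto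
    thus ?thesis by (auto simp: phase_def)
  qed
  have ind: "indep_vars (\<lambda>_. P) F {1..}" using F by (simp add: iid_payoffs_def)
  have Fm: "F t \<in> measurable M P" if "t \<ge> 1" for t
    using ind that by (auto simp: indep_vars_def)
  have Fb: "F t \<omega> y \<in> {0..1}" if "t \<ge> 1" "\<omega> \<in> space M" for t \<omega>
    using measurable_space[OF Fm] that space_experts_instance[OF P] by (auto simp: Pi_iff)
  have "indep_vars (\<lambda>_. borel) (\<lambda>t \<omega>. F t \<omega> y) {1..}"
    using indep_vars_compose2[OF ind, of "\<lambda>_ f. f y" "\<lambda>_. borel"] eval_measurable[OF P] by simp
  hence ind': "indep_vars (\<lambda>_. borel) (\<lambda>t \<omega>. F t \<omega> y) (phase i)"
    using sub by (rule indep_vars_subset)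
  have E: "expectation (\<lambda>\<omega>. F t \<omega> y) = mean_payoff P y" if "t \<in> phase i" for t
  proof -
    have t: "t \<ge> 1" using sub that by auto
    have "mean_payoff P y = (\<integral>f. f y \<partial>distr M P (F t))"
      using F t by (simp add: mean_payoff_def iid_payoffs_def)
    also have "\<dots> = expectation (\<lambda>\<omega>. F t \<omega> y)"
      by (rule integral_distr[OF Fm[OF t] eval_measurable[OF P]])
    finally show ?thesis ..
  qed
  define m where "m = (\<Sum>t\<in>phase i. expectation (\<lambda>\<omega>. F t \<omega> y))"
  have m: "m = 2 ^ i * mean_payoff P y" by (simp add: m_def E card_phase)
  \<comment> \<open>The squared interval widths sum to \<open>2 ^ i\<close>, so a deviation of
    \<open>2 ^ i * \<epsilon>\<close> in the sum gives the exponent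
    \<open>- 2 * 2 ^ i * \<epsilon>\<^sup>2\<close>.\<close>
  interpret H: Hoeffding_ineq M "phase i" "\<lambda>t \<omega>. F t \<omega> y" "\<lambda>_. 0" "\<lambda>_. 1" m
    by unfold_locales (use sub Fb ind' in \<open>auto simp: phase_def m_def intro!: AE_I2\<close>)
  have dev: "\<bar>sample_average F i \<omega> y - mean_payoff P y\<bar> = \<bar>(\<Sum>t\<in>phase i. F t \<omega> y) - m\<bar> / 2 ^ i" for \<omega>
  proof -
    have "sample_average F i \<omega> y - mean_payoff P y = ((\<Sum>t\<in>phase i. F t \<omega> y) - m) / 2 ^ i"
      by (simp add: sample_average_def m field_simps)
    thus ?thesis by simp
  qed
  have eq: "{\<omega>\<in>space M. \<epsilon> \<le> \<bar>sample_average F i \<omega> y - mean_payoff P y\<bar>}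
      = {\<omega>\<in>space M. \<bar>(\<Sum>t\<in>phase i. F t \<omega> y) - m\<bar> \<ge> 2 ^ i * \<epsilon>}"
    unfolding dev by (simp add: field_simps)
  show ?bound
    using H.Hoeffding_ineq_abs_ge[of "2 ^ i * \<epsilon>"] \<open>\<epsilon> \<ge> 0\<close>
    by (simp add: eq card_phase power2_eq_square field_simps)
  have "(\<lambda>\<omega>. F t \<omega> y) \<in> borel_measurable M" if "t \<in> phase i" for t
    using that by (rule H.random_variable)
  hence [measurable]: "(\<lambda>\<omega>. \<Sum>t\<in>phase i. F t \<omega> y) \<in> borel_measurable M" by (rule borel_measurable_sum)
  show "{\<omega>\<in>space M. \<epsilon> \<le> \<bar>sample_average F i \<omega> y - mean_payoff P y\<bar>} \<in> sets M"
    unfolding eq by measurable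
qed

text \<open>Either all sample averages over the net are within \<open>\<delta>\<close> of their means, and then the best
  guess is \<open>3\<delta>\<close>-optimal, or the loss is at most 1.\<close>

lemma best_guess_gap:
  fixes P :: "('a::metric_space \<Rightarrow> real) measure" and g :: "'w \<Rightarrow> 'a"
  assumes P: "experts_instance P" and F: "iid_payoffs M P F" and i: "i \<ge> 1" and "\<delta> \<ge> 0"
    and S: "finite S" "UNIV \<subseteq> (\<Union>y\<in>S. cball y \<delta>)"
    and g: "\<And>\<omega>. \<omega> \<in> space M \<Longrightarrow> g \<omega> \<in> S"
      "\<And>\<omega> y. \<omega> \<in> space M \<Longrightarrow> y \<in> S \<Longrightarrow> sample_average F i \<omega> y \<le> sample_average F i \<omega> (g \<omega>)"
    and "g \<in> borel_measurable M"
  shows "(SUP y. mean_payoff P y) - (\<integral>\<omega>. mean_payoff P (g \<omega>) \<partial>M)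
    \<le> 3 * \<delta> + 2 * real (card S) * exp (- 2 * 2 ^ i * \<delta>\<^sup>2)"
proof -
  interpret prob_space M using F by (simp add: iid_payoffs_def)
  let ?\<mu> = "mean_payoff P"
  define bad where "bad y = {\<omega>\<in>space M. \<delta> \<le> \<bar>sample_average F i \<omega> y - ?\<mu> y\<bar>}" for y
  define B where "B = (\<Union>y\<in>S. bad y)"
  note dev = prob_sample_average_deviation[OF P F i \<open>\<delta> \<ge> 0\<close>, folded bad_def]
  have B [measurable]: "B \<in> sets M" unfolding B_def using S dev(2) by blast
  have lip: "1-lipschitz_on UNIV ?\<mu>" using P by (simp add: experts_instance_def)
  \<comment> \<open>The mean payoff is Lipschitz, hence continuous, so its value at the random point
    \<open>g \<omega>\<close> is a random variable.\<close>
  have [measurable]: "?\<mu> \<in> borel_measurable borel"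
    using lip by (intro borel_measurable_continuous_onI) (rule lipschitz_on_continuous_on)
  note [measurable] = \<open>g \<in> borel_measurable M\<close>
  have int: "integrable M (\<lambda>\<omega>. ?\<mu> (g \<omega>))"
    using mean_payoff_bounds[OF P] by (intro integrable_const_bound[of _ 1]) auto
  have good: "(SUP y. ?\<mu> y) \<le> ?\<mu> (g \<omega>) + 3 * \<delta> + indicator B \<omega>" if \<omega>: "\<omega> \<in> space M" for \<omega>
  proof (rule cSUP_least)
    fix z :: 'a
    show "?\<mu> z \<le> ?\<mu> (g \<omega>) + 3 * \<delta> + indicator B \<omega>"
    proof (cases "\<omega> \<in> B")
      case True
      thus ?thesis using mean_payoff_bounds[OF P] \<open>\<delta> \<ge> 0\<close> by (smt (verit) indicator_simps(1))
    next
      case False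
      \<comment> \<open>One \<open>\<delta>\<close> is lost in moving from \<open>z\<close> to the
        net point \<open>y\<close>, and one each in comparing sample average and mean at
        \<open>y\<close> and at \<open>g \<omega>\<close>.\<close>
      obtain y where y: "y \<in> S" "dist y z \<le> \<delta>"
        using subsetD[OF S(2) UNIV_I[of z]] by auto
      have "\<bar>?\<mu> z - ?\<mu> y\<bar> \<le> dist y z"
        using lipschitz_onD[OF lip, of z y] by (simp add: dist_real_def dist_commute)
      moreover have "\<bar>sample_average F i \<omega> u - ?\<mu> u\<bar> < \<delta>" if "u \<in> S" for u
        using False that \<omega> by (auto simp: B_def bad_def not_le)
      ultimately show ?thesis using g[OF \<omega>] y False
        by (smt (verit) indicator_simps(2))
    qed
  qed simp
  have "(SUP y. ?\<mu> y) = (\<integral>\<omega>. (SUP y. ?\<mu> y) \<partial>M)" by (simp add: prob_space)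
  also have "\<dots> \<le> (\<integral>\<omega>. ?\<mu> (g \<omega>) + 3 * \<delta> + indicator B \<omega> \<partial>M)"
    using good int by (intro integral_mono) (auto intro!: integrable_real_indicator simp: emeasure_eq_measure)
  also have "\<dots> = (\<integral>\<omega>. ?\<mu> (g \<omega>) \<partial>M) + 3 * \<delta> + prob B"
    using int by (simp add: prob_space emeasure_eq_measure)
  finally have "(SUP y. ?\<mu> y) - (\<integral>\<omega>. ?\<mu> (g \<omega>) \<partial>M) \<le> 3 * \<delta> + prob B" by simp
  also have "prob B \<le> (\<Sum>y\<in>S. prob (bad y))"
    unfolding B_def using S dev(2) by (intro finite_measure_subadditive_finite) auto
  also have "\<dots> \<le> (\<Sum>y\<in>S. 2 * exp (- 2 * 2 ^ i * \<delta>\<^sup>2))" by (intro sum_mono dev(1))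
  finally show ?thesis by (simp add: mult_ac)
qed

section \<open>Radii of the phases and the resulting failure probability\<close>

lemma phase_radius_eventually:
  fixes b :: real
  assumes "b > 0" "\<forall>\<^sub>F r in at_right 0. Q r"
  shows "\<forall>\<^sub>F i in sequentially. Q ((2 ^ i) powr (- 1 / (b + 2)))"
proof -
  have "filterlim (\<lambda>i. (2 ^ i) powr (- 1 / (b + 2)) :: real) (at_right 0) sequentially"
  proof (rule tendsto_imp_filterlim_at_right)
    have "filterlim (\<lambda>i. 2 ^ i :: real) at_top sequentially" by real_asymp
    thus "(\<lambda>i. (2 ^ i) powr (- 1 / (b + 2)) :: real) \<longlonglongrightarrow> 0"
      using assms by (intro tendsto_neg_powr) auto
  qed auto
  thus ?thesis using assms(2) by (auto simp: filterlim_iff)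
qed

text \<open>The Hoeffding exponent is twice \<open>\<delta> powr (- b)\<close>. One half cancels the
  size of the net, and the other leaves a factor that is \<open>O(\<delta>)\<close>.\<close>

lemma union_bound_le_radius:
  fixes b :: real
  assumes "b > 0" "\<delta> > 0" "real n \<le> exp (\<delta> powr (- b))" "T * \<delta>\<^sup>2 = \<delta> powr (- b)"
  shows "2 * real n * exp (- 2 * T * \<delta>\<^sup>2) \<le> 2 * exp (- (1 + ln b) / b) * \<delta>"
proof -
  let ?u = "\<delta> powr (- b)"
  have "- 2 * T * \<delta>\<^sup>2 = - 2 * ?u" using assms(4) by (simp add: mult.assoc)
  hence "2 * real n * exp (- 2 * T * \<delta>\<^sup>2) \<le> 2 * exp ?u * exp (- 2 * ?u)"
    using assms(3) by (simp only:) (intro mult_right_mono, auto)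
  also have "2 * exp ?u * exp (- 2 * ?u) = 2 * exp (- ?u)"
    by (simp flip: exp_add)
  also have "\<dots> \<le> 2 * (exp (- (1 + ln b) / b) * \<delta>)"
    using exp_neg_powr_le[of b \<delta>] assms by simp
  finally show ?thesis by (simp only: mult.assoc)
qed

section \<open>Regret as a sum of expected losses per round\<close>

text \<open>Linearity of expectation. Nonnegative gaps let the absolute value be dropped, and the
  bound 1 serves rounds without a useful estimate.\<close>

lemma regret_eq_sum_gaps:
  fixes P :: "('a::metric_space \<Rightarrow> real) measure" and x :: "nat \<Rightarrow> 'w \<Rightarrow> 'a"
  assumes P: "experts_instance P" and "prob_space M"
    and x: "\<forall>s\<ge>1. x s \<in> borel_measurable M"
  defines "gap \<equiv> \<lambda>s. (SUP y. mean_payoff P y) - (\<integral>\<omega>. mean_payoff P (x s \<omega>) \<partial>M)"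
  shows "regret M P x t = (\<Sum>s=1..t. gap s)"
    and "s \<ge> 1 \<Longrightarrow> 0 \<le> gap s" and "s \<ge> 1 \<Longrightarrow> gap s \<le> 1"
proof -
  interpret prob_space M by fact
  let ?\<mu> = "mean_payoff P"
  have lip: "1-lipschitz_on UNIV ?\<mu>" using P by (simp add: experts_instance_def)
  have [measurable]: "?\<mu> \<in> borel_measurable borel"
    using lip by (intro borel_measurable_continuous_onI) (rule lipschitz_on_continuous_on)
  have int: "integrable M (\<lambda>\<omega>. ?\<mu> (x s \<omega>))" if "s \<ge> 1" for s
  proof -
    have [measurable]: "x s \<in> borel_measurable M" using x that by blast
    show ?thesis
      using mean_payoff_bounds[OF P] by (intro integrable_const_bound[of _ 1]) auto
  qed
  have "(\<integral>\<omega>. (\<Sum>s=1..t. ?\<mu> (x s \<omega>)) \<partial>M) = (\<Sum>s=1..t. \<integral>\<omega>. ?\<mu> (x s \<omega>) \<partial>M)"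
    using int by (intro Bochner_Integration.integral_sum) auto
  thus "regret M P x t = (\<Sum>s=1..t. gap s)"
    by (simp add: regret_def gap_def sum_subtractf)
  have bdd: "bdd_above (range ?\<mu>)" using mean_payoff_bounds[OF P] by (intro bdd_aboveI[of _ 1]) auto
  show "0 \<le> gap s" if "s \<ge> 1"
    unfolding gap_def using integral_le_const[OF int[OF that]] cSUP_upper[OF _ bdd] by simp
  have "(SUP y. ?\<mu> y) \<le> 1" using mean_payoff_bounds[OF P] by (intro cSUP_least) auto
  moreover have "0 \<le> (\<integral>\<omega>. ?\<mu> (x s \<omega>) \<partial>M)"
    by (intro integral_nonneg_AE AE_I2 mean_payoff_bounds(1)[OF P])
  ultimately show "gap s \<le> 1" unfolding gap_def by simp
qed

text \<open>The mean payoff is constant on a single point. There \<open>LCD\<close> is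
  \<open>- \<infinity>\<close>, so \<open>b\<close> can be any real and this case is settled
  separately.\<close>

lemma regret_singleton:
  fixes P :: "('a::metric_space \<Rightarrow> real) measure"
  assumes "\<And>u v :: 'a. u = v" and "prob_space M"
  shows "regret M P x t = 0"
proof -
  interpret prob_space M by fact
  fix z :: 'a
  have "mean_payoff P = (\<lambda>_. mean_payoff P z)" using assms(1) by (intro ext) metis
  then obtain c where "mean_payoff P = (\<lambda>_. c)" ..
  thus ?thesis by (simp add: regret_def prob_space)
qed

text \<open>Closed balls cover in both alternatives of the definition, and the later estimates need
  only distance at most \<open>\<delta>\<close>.\<close>

lemma admissible_net_cover:
  assumes "admissible_net X \<delta> S"
  shows "finite S" "enat (card S) \<le> covering_number X \<delta>" "X \<subseteq> (\<Union>y\<in>S. cball y \<delta>)"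
proof -
  have "(\<Union>y\<in>S. ball y \<delta>) \<subseteq> (\<Union>y\<in>S. cball y \<delta>)" by (intro UN_mono ball_subset_cball) simp
  moreover have "X \<subseteq> (\<Union>y\<in>S. ball y \<delta>) \<or> X \<subseteq> (\<Union>y\<in>S. cball y \<delta>)"
    using assms unfolding admissible_net_def small_hitting_set_def hitting_set_def by argo
  ultimately show "X \<subseteq> (\<Union>y\<in>S. cball y \<delta>)" by (meson subset_trans)
  show "finite S" "enat (card S) \<le> covering_number X \<delta>"
    using assms unfolding admissible_net_def small_hitting_set_def by argo+
qed

section \<open>Uniform constants and summation over the rounds\<close>

theorem theorem9p1:
  fixes b :: real
  assumes "bounded (UNIV :: 'a::metric_space set)"
    and "diameter (UNIV :: 'a set) \<le> 1"
    and "LCD (UNIV :: 'a set) < ereal b"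
  shows "\<exists>C. \<forall>(P :: ('a \<Rightarrow> real) measure) (M :: 'w measure) F S g x.
           experts_instance P \<longrightarrow> iid_payoffs M P F \<longrightarrow> naive_exp_run b M F S g x \<longrightarrow>
           (\<forall>t\<ge>1. \<bar>regret M P x t\<bar> \<le> C * real t powr (1 - 1 / (b + 2)))"
proof (cases "\<forall>u v :: 'a. u = v")
  case True
  thus ?thesis by (intro exI[of _ 0]) (simp add: iid_payoffs_def regret_singleton)
next
  case False
  then obtain u v :: 'a where "u \<noteq> v" by blast
  hence "0 \<le> LCD (UNIV :: 'a set)" by (intro LCD_nonneg) auto
  hence "ereal 0 < ereal b" using assms(3) by (simp only: zero_ereal_def le_less_trans)
  hence b: "b > 0" by simp
  define a where "a = 1 / (b + 2)"
  have a: "0 < a" "a \<le> 1 / 2" using b by (auto simp: a_def field_simps)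
  define \<delta> :: "nat \<Rightarrow> real" where "\<delta> i = (2 ^ i) powr (- a)" for i
  have \<delta>_alt: "(2 ^ i) powr (- 1 / (b + 2)) = \<delta> i" for i by (simp add: \<delta>_def a_def)
  have \<delta>: "\<delta> i > 0" for i by (simp add: \<delta>_def)
  \<comment> \<open>This is \<open>1 - 2 * a = a * b\<close>, which follows from
    \<open>a * (b + 2) = 1\<close>.\<close>
  have balance: "2 ^ i * (\<delta> i)\<^sup>2 = \<delta> i powr (- b)" for i
  proof -
    have "2 ^ i * (\<delta> i)\<^sup>2 = (2 ^ i) powr (1 + (- a) * 2)"
      unfolding powr_add by (simp add: \<delta>_def powr_powr flip: powr_numeral)
    also have "1 + (- a) * 2 = (- a) * (- b)" using b by (simp add: a_def field_simps)
    finally show ?thesis by (simp add: \<delta>_def powr_powr)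
  qed
  \<comment> \<open>The threshold \<open>i0\<close> depends only on \<open>b\<close> and the space,
    so the final constant is uniform over all instances and runs.\<close>
  obtain i0 where i0: "\<And>i. i \<ge> i0 \<Longrightarrow>
      \<exists>m. covering_number (UNIV :: 'a set) (\<delta> i) = enat m \<and> real m \<le> exp (\<delta> i powr (- b))"
    using phase_radius_eventually[OF b eventually_covering_number_le_exp[OF assms(3)]]
    unfolding \<delta>_alt eventually_sequentially by blast
  \<comment> \<open>The 3 is the accuracy loss, the second term comes from the union bound, and
    \<open>1 / \<delta> i0\<close> makes \<open>K * \<delta> i \<ge> 1\<close> in the phases before
    \<open>i0\<close>.\<close>
  define K where "K = 3 + 2 * exp (- (1 + ln b) / b) + 1 / \<delta> i0"
  have K: "K \<ge> 3" using \<delta>[of i0] by (simp add: K_def)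
  show ?thesis
  proof (intro exI allI impI)
    fix P :: "('a \<Rightarrow> real) measure" and M :: "'w measure" and F S g x and t :: nat
    assume P: "experts_instance P" and F: "iid_payoffs M P F"
      and run: "naive_exp_run b M F S g x" and "t \<ge> 1"
    have M: "prob_space M" using F by (simp add: iid_payoffs_def)
    have x: "\<forall>s\<ge>1. x s \<in> borel_measurable M"
      using run by (simp add: naive_exp_run_def)
    define gap where "gap s = (SUP y. mean_payoff P y) - (\<integral>\<omega>. mean_payoff P (x s \<omega>) \<partial>M)" for s
    note gap = regret_eq_sum_gaps[OF P M x, folded gap_def]
    have gap_le: "gap s \<le> 4 * K * real s powr (- a)" if s: "s \<ge> 1" for s
    proof (cases "s \<ge> 3")
      case True
      then obtain i where i: "i \<ge> 1" "s \<in> phase (i + 1)" "real s \<le> 4 * 2 ^ i"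
        by (rule phase_cover)
      have "gap s \<le> K * \<delta> i"
      proof (cases "i \<ge> i0")
        case True
        obtain m where m: "covering_number (UNIV :: 'a set) (\<delta> i) = enat m"
          "real m \<le> exp (\<delta> i powr (- b))" using i0[OF True] by blast
        have "admissible_net UNIV (\<delta> i) (S i)"
          using run i unfolding naive_exp_run_def \<delta>_alt by blast
        note net = admissible_net_cover[OF this]
        have xg: "x s \<omega> = g i \<omega>" if "\<omega> \<in> space M" for \<omega>
          using run i that unfolding naive_exp_run_def by blast
        have "gap s \<le> 3 * \<delta> i + 2 * real (card (S i)) * exp (- 2 * 2 ^ i * (\<delta> i)\<^sup>2)"
          unfolding gap_def
        proof (rule best_guess_gap[OF P F i(1)])
          show "x s \<omega> \<in> S i" if "\<omega> \<in> space M" for \<omega>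
            using run i(1) that xg[OF that] by (simp add: naive_exp_run_def)
          show "sample_average F i \<omega> y \<le> sample_average F i \<omega> (x s \<omega>)"
            if "\<omega> \<in> space M" "y \<in> S i" for \<omega> y
            using run i(1) that xg[OF that(1)] by (simp add: naive_exp_run_def)
        qed (use \<delta>[of i] net x s in auto)
        also have "2 * real (card (S i)) * exp (- 2 * 2 ^ i * (\<delta> i)\<^sup>2)
            \<le> 2 * exp (- (1 + ln b) / b) * \<delta> i"
          using net(2) m by (intro union_bound_le_radius b \<delta> balance) auto
        also have "3 * \<delta> i + 2 * exp (- (1 + ln b) / b) * \<delta> i
            = (3 + 2 * exp (- (1 + ln b) / b)) * \<delta> i" by (simp add: algebra_simps)
        also have "\<dots> \<le> K * \<delta> i"
          using \<delta>[of i] \<delta>[of i0] by (intro mult_right_mono) (auto simp: K_def)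
        finally show ?thesis by simp
      next
        case False
        \<comment> \<open>Radii decrease with the phase, so here the trivial bound 1 on the gap is
          enough.\<close>
        have "\<delta> i0 \<le> \<delta> i"
          unfolding \<delta>_def using False a by (intro powr_mono2') auto
        hence "1 \<le> 1 / \<delta> i0 * \<delta> i" using \<delta>[of i0] by (simp add: field_simps)
        also have "\<dots> \<le> K * \<delta> i"
          using \<delta>[of i] by (intro mult_right_mono) (auto simp: K_def intro!: add_nonneg_nonneg)
        finally show ?thesis using gap(3)[OF s] by simp
      qed
      \<comment> \<open>From \<open>s \<le> 4 * 2 ^ i\<close> the factor is \<open>4 powr a\<close>,
        rounded up to 4.\<close>
      also have "\<delta> i \<le> 4 * real s powr (- a)"
      proof -
        have "(4 * 2 ^ i) powr (- a) \<le> real s powr (- a)"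
          using i s a by (intro powr_mono2') auto
        hence "4 powr (- a) * \<delta> i \<le> real s powr (- a)" by (simp add: \<delta>_def powr_mult)
        hence "\<delta> i \<le> 4 powr a * real s powr (- a)" by (simp add: powr_minus field_simps)
        also have "4 powr a \<le> (4::real) powr 1" using a by (intro powr_mono) auto
        finally show ?thesis by (simp add: mult_right_mono)
      qed
      finally show ?thesis using K by (simp add: mult_left_mono)
    next
      case False
      \<comment> \<open>Only rounds 1 and 2 remain. There \<open>s powr (- a) \<ge> 1 / 2\<close>
        and \<open>4 * K \<ge> 12\<close>, so the right-hand side exceeds the trivial bound
        1.\<close>
      have "(1::real) / 2 = 2 powr (- 1)" by (simp add: powr_minus)
      also have "\<dots> \<le> 2 powr (- a)" using a by (intro powr_mono) auto
      also have "\<dots> \<le> real s powr (- a)" using a s False by (intro powr_mono2') auto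
      finally have "1 / 2 \<le> real s powr (- a)" .
      hence "12 * (1 / 2) \<le> 4 * K * real s powr (- a)" using K by (intro mult_mono) auto
      thus ?thesis using gap(3)[OF s] by simp
    qed
    have "\<bar>regret M P x t\<bar> = (\<Sum>s=1..t. gap s)"
      using gap(2) by (subst gap(1)) (auto intro!: abs_of_nonneg sum_nonneg)
    also have "\<dots> \<le> (\<Sum>s=1..t. 4 * K * real s powr (- a))"
      by (intro sum_mono gap_le) auto
    also have "\<dots> \<le> 4 * K * (2 * real t powr (1 - a))"
      unfolding sum_distrib_left[symmetric] using a K
      by (intro mult_left_mono sum_powr_neg_le) auto
    finally show "\<bar>regret M P x t\<bar> \<le> (8 * K) * real t powr (1 - 1 / (b + 2))"
      by (simp add: a_def)
  qed
qed

end
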